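(* Let $n\ge 1$. With $\mathbf{Q}_n,\mathbf{T}_n$ as in the context, the following identities hold: $$Q(n)=\sum_{i=1}^{2n}(-1)^{i}\binom{4n-i-2}{2n-i}\sum_{s\in S_{4n-2,i}}\mathrm{per}(\mathbf{Q}_n|s),$$ $$T(n)=\sum_{i=1}^{2n}(-1)^{i}\sum_{s\in S_{2n,i}}\mathrm{per}(\mathbf{T}_n|s),$$ $$S(n)=\sum_{\mathbf{M}\in U_n}(-1)^{\gamma(\mathbf{M})+n}\,\mathrm{per}(\mathbf{M})\binom{2n-\gamma(\mathbf{M})-1}{n-\gamma(\mathbf{M})},$$ $$TS(n)=\sum_{\mathbf{M}\in V_n}(-1)^{\sigma(\mathbf{M})+n}\,\mathrm{per}(\mathbf{M}).$$
   Context: $\mathrm{per}(A)=\sum_{\sigma\in S_n}\prod_i a_{i,\sigma(i)}$. $\mathbf{Q}_n$ is the $n\times n$ matrix in the $4n-2$ variables $x_1,\dots,x_{2n-1},y_1,\dots,y_{2n-1}$ with $(i,j)$ entry $x_{n-i+j}y_{2n-i-j+1}$; $\mathbf{T}_n$ is the $n\times n$ matrix in the $2n$ variables $x_r,y_r$ ($r\in\mathbb{Z}/n\mathbb{Z}$) with $(i,j)$ entry $x_{(n-i+j)\bmod n}y_{(2n-i-j+1)\bmod n}$. Fix an ordering of the variables of each matrix; $S_{m,k}=\{s\in\{0,1\}^m:\sum s_i=k\}$, and for a matrix $\mathbf{A}$ in $m$ variables and $s\in\{0,1\}^m$, $\mathbf{A}|s$ is the $(0,1)$ matrix obtained by substituting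 the $l$-th variable by $s_l$. $U_n$ is the set of all $n\times n$ $(0,1)$ matrices that are diagonally constant ($m_{i,j}=m_{i+1,j+1}$), and $\gamma(\mathbf{M})$ is the number of its northwest-southeast diagonals (out of $2n-1$) whose entries are $1$. $V_n$ is the set of all $n\times n$ $(0,1)$ circulant matrices ($m_{i,j}=m_{i+1,(j+1)\bmod n}$, indices mod $n$), and $\sigma(\mathbf{M})$ is the number of ones in the first row. Binomial coefficients $\binom{a}{b}$ with $b<0$ are $0$. Board squares are $(i,j)$ (row $i$, column $j$). $Q(n)$: number of placements of $n$ queens on the $n\times n$ board with no two sharing a row, column, value of $j-i$, or value of $i+j$. $S(n)$: number of placements of $n$ pieces with no two sharing a row, column, or value of $j-i$. $T(n)$: same as $Q(n)$ but with $j-i$ and $i+j$ taken mod $n$. $TS(n)$: same as $S(n)$ but with $j-i$ taken mod $n$. *)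

theory Defs
  imports "Jordan_Normal_Form.Matrix" "HOL-Library.Poly_Mapping" "HOL-Combinatorics.Permutations"
begin

definition permanent :: "'a::comm_semiring_1 mat \<Rightarrow> 'a" where
  "permanent A = (\<Sum>p | p permutes {0..<dim_row A}. \<Prod>i=0..<dim_row A. A $$ (i, p i))"

(* Matrices of the library are indexed from 0; the function below is given
   the row and column numbers counted from 1. *)
definition square_mat_from_1 :: "nat \<Rightarrow> (nat \<Rightarrow> nat \<Rightarrow> 'a) \<Rightarrow> 'a mat" where
  "square_mat_from_1 n f = mat n n (\<lambda>(i, j). f (i + 1) (j + 1))"


(* Polynomials over the integers in the variables x_r, y_r, as finitely supported
   maps from monomials to coefficients, a monomial being a finitely supported map
   from variables to exponents. The ring operations are those of Poly_Mapping. *)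

datatype matvar = Xvar nat | Yvar nat

type_synonym int_mpoly = "(matvar \<Rightarrow>\<^sub>0 nat) \<Rightarrow>\<^sub>0 int"

definition var_poly :: "matvar \<Rightarrow> int_mpoly" where
  "var_poly v = Poly_Mapping.single (Poly_Mapping.single v 1) 1"

definition poly_at :: "(matvar \<Rightarrow> int) \<Rightarrow> int_mpoly \<Rightarrow> int" where
  "poly_at a P = (\<Sum>m\<in>Poly_Mapping.keys P. Poly_Mapping.lookup P m *
     (\<Prod>v\<in>Poly_Mapping.keys m. a v ^ Poly_Mapping.lookup m v))"

definition Q_vars :: "nat \<Rightarrow> matvar set" where
  "Q_vars n = Xvar ` {1..2*n-1} \<union> Yvar ` {1..2*n-1}"

(* The natural number subtractions in the subscripts are not truncated,
   since i and j range over 1..n. *)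
definition Q_mat :: "nat \<Rightarrow> int_mpoly mat" where
  "Q_mat n = square_mat_from_1 n (\<lambda>i j.
     var_poly (Xvar (n - i + j)) * var_poly (Yvar (2*n - i - j + 1)))"

(* Subscripts in Z/nZ are represented by 0..n-1. *)
definition T_vars :: "nat \<Rightarrow> matvar set" where
  "T_vars n = Xvar ` {0..<n} \<union> Yvar ` {0..<n}"

definition T_mat :: "nat \<Rightarrow> int_mpoly mat" where
  "T_mat n = square_mat_from_1 n (\<lambda>i j.
     var_poly (Xvar ((n - i + j) mod n)) * var_poly (Yvar ((2*n - i - j + 1) mod n)))"

definition S_set :: "nat \<Rightarrow> nat \<Rightarrow> int list set" where
  "S_set m k = {s. length s = m \<and> set s \<subseteq> {0, 1} \<and> sum_list s = int k}"

definition is_ordering_of :: "'a list \<Rightarrow> 'a set \<Rightarrow> bool" where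
  "is_ordering_of vs V \<longleftrightarrow> distinct vs \<and> set vs = V"

(* A|s for the ordering vs of the variables of A. *)
definition subst_mat :: "matvar list \<Rightarrow> int_mpoly mat \<Rightarrow> int list \<Rightarrow> int mat" where
  "subst_mat vs A s = map_mat (poly_at (\<lambda>v. the (map_of (zip vs s) v))) A"


definition U_set :: "nat \<Rightarrow> int mat set" where
  "U_set n = {M \<in> carrier_mat n n. elements_mat M \<subseteq> {0, 1} \<and>
     (\<forall>i j. i + 1 < n \<longrightarrow> j + 1 < n \<longrightarrow> M $$ (i, j) = M $$ (i + 1, j + 1))}"

(* A northwest-southeast diagonal consists of the squares with a fixed value d of j - i. *)
definition \<gamma> :: "int mat \<Rightarrow> nat" where
  "\<gamma> M = (let n = int (dim_row M) in
     card {d \<in> {- (n - 1)..n - 1}.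
       \<forall>i<dim_row M. \<forall>j<dim_col M. int j - int i = d \<longrightarrow> M $$ (i, j) = 1})"

definition V_set :: "nat \<Rightarrow> int mat set" where
  "V_set n = {M \<in> carrier_mat n n. elements_mat M \<subseteq> {0, 1} \<and>
     (\<forall>i<n. \<forall>j<n. M $$ (i, j) = M $$ ((i + 1) mod n, (j + 1) mod n))}"

definition \<sigma> :: "int mat \<Rightarrow> nat" where
  "\<sigma> M = card {j. j < dim_col M \<and> M $$ (0, j) = 1}"

(* The lower index is an integer because n - \<gamma> M can be negative; the upper index
   2n - \<gamma> M - 1 never is, as there are only 2n - 1 diagonals. *)
definition binom :: "nat \<Rightarrow> int \<Rightarrow> nat" where
  "binom a b = (if b < 0 then 0 else a choose nat b)"


definition placements :: "nat \<Rightarrow> (nat \<times> nat) set set" where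
  "placements n = {P. P \<subseteq> {1..n} \<times> {1..n} \<and> card P = n}"

definition queens :: "nat \<Rightarrow> nat" where
  "queens n = card {P \<in> placements n. inj_on fst P \<and> inj_on snd P \<and>
     inj_on (\<lambda>(i, j). int j - int i) P \<and> inj_on (\<lambda>(i, j). i + j) P}"

definition semi_queens :: "nat \<Rightarrow> nat" where
  "semi_queens n = card {P \<in> placements n. inj_on fst P \<and> inj_on snd P \<and>
     inj_on (\<lambda>(i, j). int j - int i) P}"

definition toroidal_queens :: "nat \<Rightarrow> nat" where
  "toroidal_queens n = card {P \<in> placements n. inj_on fst P \<and> inj_on snd P \<and>
     inj_on (\<lambda>(i, j). (int j - int i) mod int n) P \<and> inj_on (\<lambda>(i, j). (i + j) mod n) P}"

definition toroidal_semi_queens :: "nat \<Rightarrow> nat" where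
  "toroidal_semi_queens n = card {P \<in> placements n. inj_on fst P \<and> inj_on snd P \<and>
     inj_on (\<lambda>(i, j). (int j - int i) mod int n) P}"

end

theory Submission
  imports Defs
begin

text \<open>
  A permutation \<open>p\<close> is a placement of rooks; let \<open>W p\<close> be the set of diagonals (variables) that it
  meets. It meets at most \<open>k\<close> diagonals, and no two rooks share a diagonal iff it meets exactly \<open>k\<close>,
  where \<open>k\<close> is \<open>2n\<close> for queens and \<open>n\<close> for semi-queens. Setting the variables in \<open>S\<close> to 1 and the
  others to 0, the permanent counts the \<open>p\<close> with \<open>W p \<subseteq> S\<close>. If \<open>m\<close> is the number of variables, the
  weight \<open>(-1)\<close> to the power \<open>card S + k\<close> times \<open>(m - card S) choose (k - card S)\<close> summed over all
  \<open>S \<supseteq> W p\<close> is 1 if \<open>card (W p) = k\<close> and 0 if \<open>card (W p) < k\<close>, because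
  \<open>(a choose j) * ((a - j) choose (b - j)) = (a choose b) * (b choose j)\<close> turns it into an alternating sum of binomial
  coefficients. In the toroidal cases \<open>m = k\<close>, so the binomial weight is 1.
\<close>

section \<open>Alternating binomial sums over supersets\<close>

lemma sum_Pow_card:
  fixes f :: "nat \<Rightarrow> int"
  assumes "finite A"
  shows "(\<Sum>T\<in>Pow A. f (card T)) = (\<Sum>j\<le>card A. int (card A choose j) * f j)"
proof -
  have "(\<Sum>T\<in>Pow A. f (card T)) = (\<Sum>j\<le>card A. \<Sum>T | T \<in> Pow A \<and> card T = j. f (card T))"
    using assms by (intro sum.group[symmetric]) (auto intro: card_mono)
  also have "\<dots> = (\<Sum>j\<le>card A. int (card A choose j) * f j)"
    using n_subsets[OF assms] by (intro sum.cong) auto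
  finally show ?thesis .
qed

lemma alternating_superset_sum:
  assumes "finite V" "W \<subseteq> V" "card W \<le> k" "k \<le> card V"
  shows "(\<Sum>S | W \<subseteq> S \<and> S \<subseteq> V.
      (-1) ^ (card S + k) * int (binom (card V - card S) (int k - int (card S)))) =
    of_bool (card W = k)"
proof -
  \<comment> \<open>With \<open>S = W \<union> T\<close> and \<open>T\<close> disjoint from
    \<open>W\<close>, sign and binomial depend only on \<open>card T\<close>, on the number
    \<open>a\<close> of free elements and on the deficit \<open>b\<close>.\<close>
  define a b where "a = card (V - W)" and "b = k - card W"
  have fW: "finite W" using assms finite_subset by blast
  have cV: "card V = card W + a"
    using assms fW by (simp add: a_def card_Diff_subset card_mono)
  have k: "k = card W + b" and ab: "b \<le> a"
    using assms cV by (auto simp: b_def)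
  have "(\<Sum>S | W \<subseteq> S \<and> S \<subseteq> V.
      (-1) ^ (card S + k) * int (binom (card V - card S) (int k - int (card S)))) =
    (\<Sum>T\<in>Pow (V - W). (-1) ^ (card T + b) * int (binom (a - card T) (int b - int (card T))))"
  proof (rule sum.reindex_bij_witness[of _ "\<lambda>T. W \<union> T" "\<lambda>S. S - W"])
    fix S assume S: "S \<in> {S. W \<subseteq> S \<and> S \<subseteq> V}"
    then have fS: "finite S" using assms(1) finite_subset by blast
    have "card S = card W + card (S - W)"
      using S fW fS by (simp add: card_Diff_subset card_mono)
    then show "(-1) ^ (card (S - W) + b) * int (binom (a - card (S - W)) (int b - int (card (S - W)))) =
        (-1) ^ (card S + k) * int (binom (card V - card S) (int k - int (card S)))"
      \<comment> \<open>The exponents \<open>card S + k\<close> and \<open>card T + b\<close>, for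
        \<open>T = S - W\<close>, differ by \<open>2 * card W\<close>, so the signs agree.\<close>
      by (simp add: cV k power_add flip: power_mult_distrib)
  qed (use assms in auto)
  also have "\<dots> = (\<Sum>j\<le>a. int (a choose j) * ((-1) ^ (j + b) * int (binom (a - j) (int b - int j))))"
    unfolding a_def using assms(1) by (intro sum_Pow_card) auto
  \<comment> \<open>For \<open>j > b\<close> the lower index is negative and \<open>binom\<close> is
    0.\<close>
  also have "\<dots> = (\<Sum>j\<le>b. int (a choose j) * ((-1) ^ (j + b) * int (binom (a - j) (int b - int j))))"
    using ab by (intro sum.mono_neutral_right) (auto simp: binom_def)
  also have "\<dots> = (\<Sum>j\<le>b. int (a choose b) * (-1) ^ b * ((-1) ^ j * int (b choose j)))"
  proof (rule sum.cong[OF refl])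
    fix j assume "j \<in> {..b}"
    then have j: "j \<le> b" by simp
    have "int (a choose b) * int (b choose j) = int (a choose j) * int ((a - j) choose (b - j))"
      unfolding of_nat_mult[symmetric] using choose_mult[OF j ab] by simp
    moreover have "binom (a - j) (int b - int j) = (a - j) choose (b - j)"
      using j by (simp add: binom_def nat_diff_distrib)
    ultimately show "int (a choose j) * ((-1) ^ (j + b) * int (binom (a - j) (int b - int j))) =
        int (a choose b) * (-1) ^ b * ((-1) ^ j * int (b choose j))"
      by (simp add: power_add mult_ac)
  qed
  also have "\<dots> = int (a choose b) * (-1) ^ b * (\<Sum>j\<le>b. (-1) ^ j * int (b choose j))"
    by (simp add: sum_distrib_left)
  also have "\<dots> = of_bool (card W = k)"
    \<comment> \<open>The alternating row sum vanishes for \<open>b > 0\<close>; for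
      \<open>b = 0\<close> the single term is 1.\<close>
    using k choose_alternating_sum[of b, where ?'a = int] by (cases "b = 0") auto
  finally show ?thesis .
qed

section \<open>Permanents of 0-1 matrices and the sieve\<close>

text \<open>The label of a square is the set of diagonals through it that matter: two of them for
  queens, one for semi-queens. This one form covers the substituted matrices as well as the
  diagonally constant and the circulant ones.\<close>

definition label_mat :: "nat \<Rightarrow> (nat \<Rightarrow> nat \<Rightarrow> 'v set) \<Rightarrow> 'v set \<Rightarrow> int mat" where
  "label_mat n lab S = mat n n (\<lambda>(i, j). of_bool (lab i j \<subseteq> S))"

lemma permanent_label_mat:
  "permanent (label_mat n lab S) =
    (\<Sum>p | p permutes {0..<n}. of_bool ((\<Union>i\<in>{0..<n}. lab i (p i)) \<subseteq> S))"
proof -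
  have "(\<Prod>i=0..<n. label_mat n lab S $$ (i, p i)) =
      of_bool ((\<Union>i\<in>{0..<n}. lab i (p i)) \<subseteq> S)" if "p permutes {0..<n}" for p
  proof -
    have "(\<Prod>i=0..<n. label_mat n lab S $$ (i, p i)) = (\<Prod>i=0..<n. of_bool (lab i (p i) \<subseteq> S))"
      using permutes_in_image[OF that] by (intro prod.cong) (auto simp: label_mat_def)
    also have "\<dots> = of_bool (\<forall>i\<in>{0..<n}. lab i (p i) \<subseteq> S)"
      by (cases "\<forall>i\<in>{0..<n}. lab i (p i) \<subseteq> S") auto
    finally show ?thesis by (simp add: UN_subset_iff)
  qed
  then show ?thesis by (simp add: permanent_def label_mat_def)
qed

text \<open>Exchanging the sums over \<open>S\<close> and \<open>p\<close> leaves, for each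
  \<open>p\<close>, a sum over the supersets of its labels, which
  \<open>alternating_superset_sum\<close> evaluates. The bound \<open>le\<close> is what allows that
  evaluation for every \<open>p\<close>.\<close>

lemma card_permutes_sieve:
  assumes "finite V" "k \<le> card V"
    and lab: "\<And>i j. i < n \<Longrightarrow> j < n \<Longrightarrow> lab i j \<subseteq> V"
    and le: "\<And>p. p permutes {0..<n} \<Longrightarrow> card (\<Union>i\<in>{0..<n}. lab i (p i)) \<le> k"
  shows "int (card {p. p permutes {0..<n} \<and> card (\<Union>i\<in>{0..<n}. lab i (p i)) = k}) =
    (\<Sum>S\<in>Pow V. (-1) ^ (card S + k) * permanent (label_mat n lab S) *
      int (binom (card V - card S) (int k - int (card S))))"
proof -
  define W where "W p = (\<Union>i\<in>{0..<n}. lab i (p i))" for p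
  define c where "c S = (-1) ^ (card S + k) * int (binom (card V - card S) (int k - int (card S)))"
    for S :: "'a set"
  have fin: "finite {p. p permutes {0..<n}}" by (simp add: finite_permutations)
  have "(\<Sum>S\<in>Pow V. (-1) ^ (card S + k) * permanent (label_mat n lab S) *
      int (binom (card V - card S) (int k - int (card S)))) =
    (\<Sum>S\<in>Pow V. \<Sum>p | p permutes {0..<n}. of_bool (W p \<subseteq> S) * c S)"
    unfolding permanent_label_mat W_def c_def
    by (simp add: sum_distrib_left sum_distrib_right mult_ac)
  also have "\<dots> = (\<Sum>p | p permutes {0..<n}. \<Sum>S\<in>Pow V. of_bool (W p \<subseteq> S) * c S)"
    by (rule sum.swap)
  also have "\<dots> = (\<Sum>p | p permutes {0..<n}. of_bool (card (W p) = k))"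
  proof (rule sum.cong[OF refl])
    fix p assume "p \<in> {p. p permutes {0..<n}}"
    then have p: "p permutes {0..<n}" by simp
    have "W p \<subseteq> V" unfolding W_def using lab permutes_in_image[OF p] by fastforce
    moreover have "(\<Sum>S\<in>Pow V. of_bool (W p \<subseteq> S) * c S) = (\<Sum>S | W p \<subseteq> S \<and> S \<subseteq> V. c S)"
      using assms(1) by (intro sum.mono_neutral_cong_right) auto
    ultimately show "(\<Sum>S\<in>Pow V. of_bool (W p \<subseteq> S) * c S) = of_bool (card (W p) = k)"
      using alternating_superset_sum[OF assms(1) _ _ assms(2)] le[OF p]
      by (simp add: c_def W_def)
  qed
  also have "\<dots> = int (card {p. p permutes {0..<n} \<and> card (W p) = k})"
    using fin by (simp add: Int_def sum_of_bool_eq)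
  finally show ?thesis by (simp add: W_def)
qed

section \<open>Placements as permutations\<close>

text \<open>\<open>n\<close> squares in distinct rows fill every row once, so they form the graph of
  a function; distinct columns make it injective, hence a permutation. \<open>R\<close> stands for
  the diagonal conditions. The shift by 1 reconciles a board numbered from 1 with permutations of
  \<open>{0..<n}\<close>.\<close>

lemma card_placements_permutes:
  "card {P \<in> placements n. inj_on fst P \<and> inj_on snd P \<and> R P} =
    card {p. p permutes {0..<n} \<and> R ((\<lambda>i. (i + 1, p i + 1)) ` {0..<n})}"
proof -
  define G where "G p = (\<lambda>i. (i + 1, p i + 1)) ` {0..<n}" for p :: "nat \<Rightarrow> nat"
  have inj: "inj_on G {p. p permutes {0..<n}}"
  proof (rule inj_onI)
    fix p q assume "p \<in> {p. p permutes {0..<n}}" "q \<in> {p. p permutes {0..<n}}" and eq: "G p = G q"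
    then have p: "p permutes {0..<n}" and q: "q permutes {0..<n}" by auto
    show "p = q"
    proof
      fix i
      show "p i = q i"
      proof (cases "i < n")
        case True
        then have "(i + 1, p i + 1) \<in> G q" unfolding eq[symmetric] by (auto simp: G_def)
        then show ?thesis by (auto simp: G_def)
      next
        case False
        then show ?thesis using p q by (simp add: permutes_not_in)
      qed
    qed
  qed
  have to: "G p \<in> placements n \<and> inj_on fst (G p) \<and> inj_on snd (G p)" if p: "p permutes {0..<n}" for p
  proof -
    have "inj_on p {0..<n}" using p by (rule permutes_inj_on)
    then have "inj_on snd (G p)" by (auto simp: G_def inj_on_def)
    moreover have "inj_on fst (G p)" by (auto simp: G_def inj_on_def)
    moreover have "card (G p) = n" unfolding G_def by (subst card_image) (auto simp: inj_on_def)
    moreover have "p i < n" if "i < n" for i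
      using that permutes_in_image[OF p, of i] by simp
    then have "G p \<subseteq> {1..n} \<times> {1..n}" by (auto simp: G_def Suc_le_eq)
    ultimately show ?thesis by (simp add: placements_def)
  qed
  have onto: "\<exists>p. p permutes {0..<n} \<and> P = G p"
    if P: "P \<in> placements n" and f: "inj_on fst P" and s: "inj_on snd P" for P
  proof -
    from P have sub: "P \<subseteq> {1..n} \<times> {1..n}" and c: "card P = n" by (auto simp: placements_def)
    have fP: "finite P" using sub finite_subset by blast
    have f1: "fst ` P = {1..n}"
      using sub c f by (intro card_subset_eq) (auto simp: card_image)
    have "\<exists>j. (i + 1, j + 1) \<in> P \<and> j < n" if "i < n" for i
    proof -
      have "i + 1 \<in> fst ` P" using that f1 by simp
      then obtain j where j: "(i + 1, j) \<in> P" by auto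
      then have "j \<in> {1..n}" using sub by auto
      then show ?thesis using j by (intro exI[of _ "j - 1"]) auto
    qed
    then obtain g where g: "\<And>i. i < n \<Longrightarrow> (i + 1, g i + 1) \<in> P \<and> g i < n" by metis
    \<comment> \<open>\<open>permutes\<close> demands the identity outside \<open>{0..<n}\<close>;
      this also makes \<open>p\<close> unique.\<close>
    define p where "p i = (if i < n then g i else i)" for i
    have pg: "(i + 1, p i + 1) \<in> P" "p i < n" if "i < n" for i using g that by (auto simp: p_def)
    have "inj_on p {0..<n}"
    proof (rule inj_onI)
      fix i j assume "i \<in> {0..<n}" "j \<in> {0..<n}" "p i = p j"
      then show "i = j"
        using inj_onD[OF s, of "(i + 1, p i + 1)" "(j + 1, p j + 1)"] pg(1)[of i] pg(1)[of j] by simp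
    qed
    moreover from this have "p ` {0..<n} = {0..<n}"
      using pg(2) by (intro endo_inj_surj) auto
    ultimately have "p permutes {0..<n}"
      by (intro bij_imp_permutes) (auto simp: bij_betw_def p_def)
    moreover have "G p = P"
    \<comment> \<open>Both sets have \<open>n\<close> elements, so one inclusion suffices.\<close>
    proof (rule card_subset_eq[OF fP])
      show "G p \<subseteq> P" using pg by (auto simp: G_def)
      show "card (G p) = card P" unfolding G_def c by (subst card_image) (auto simp: inj_on_def)
    qed
    ultimately show ?thesis by blast
  qed
  have "{P \<in> placements n. inj_on fst P \<and> inj_on snd P \<and> R P} =
      G ` {p. p permutes {0..<n} \<and> R (G p)}"
    using to onto by blast
  moreover have "inj_on G {p. p permutes {0..<n} \<and> R (G p)}"
    using inj by (rule inj_on_subset) auto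
  ultimately show ?thesis by (simp add: card_image) (simp add: G_def)
qed

lemma inj_on_placement:
  "inj_on f ((\<lambda>i. (i + 1, p i + 1)) ` {0..<n}) \<longleftrightarrow> inj_on (\<lambda>i. f (i + 1, p i + 1)) {0..<n::nat}"
  by (auto simp: inj_on_def)

section \<open>Substituting 0 and 1 for the variables\<close>

lemma poly_at_var_mult:
  assumes "v \<noteq> w"
  shows "poly_at a (var_poly v * var_poly w) = a v * a w"
proof -
  have l: "Poly_Mapping.lookup (Poly_Mapping.single v (1::nat) + Poly_Mapping.single w 1) u =
      of_bool (u = v \<or> u = w)" for u
    using assms by (auto simp: lookup_add lookup_single when_def)
  have "Poly_Mapping.keys (Poly_Mapping.single v (1::nat) + Poly_Mapping.single w 1) = {v, w}"
    by (auto simp del: One_nat_def simp: in_keys_iff l)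
  then show ?thesis
    using assms by (simp del: One_nat_def add: poly_at_def var_poly_def mult_single l)
qed

text \<open>A 0-1 list along the ordering is the characteristic vector of a set of variables, and
  its sum is the size of that set. Hence the choice of the ordering does not affect which subsets
  are summed over.\<close>

lemma sum_S_set:
  assumes "is_ordering_of vs V"
  shows "(\<Sum>s\<in>S_set (card V) i. F s) =
    (\<Sum>S | S \<subseteq> V \<and> card S = i. F (map (\<lambda>v. of_bool (v \<in> S)) vs))"
proof -
  have d: "distinct vs" and V: "set vs = V" using assms by (auto simp: is_ordering_of_def)
  have len: "length vs = card V" using distinct_card[OF d] V by simp
  have sum: "sum_list (map (\<lambda>v. of_bool (v \<in> S)) vs) = int (card S)" if "S \<subseteq> V" for S
  proof -
    have "sum_list (map (\<lambda>v. of_bool (v \<in> S)) vs) = (\<Sum>v\<in>V. of_bool (v \<in> S) :: int)"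
      using d V by (simp add: sum_list_distinct_conv_sum_set)
    also have "\<dots> = int (card S)"
      using that finite_set[of vs] unfolding V by (simp add: sum_of_bool_eq Int_absorb1)
    finally show ?thesis .
  qed
  \<comment> \<open>The inverse map: the variables set to 1. As \<open>vs\<close> is distinct, a
    variable determines its position, so \<open>s\<close> is recovered from
    \<open>H s\<close>.\<close>
  define H where "H s = {vs ! l |l. l < length vs \<and> s ! l = (1::int)}" for s
  have left: "map (\<lambda>v. of_bool (v \<in> H s)) vs = s" if "s \<in> S_set (card V) i" for s
  proof (rule nth_equalityI)
    show ls: "length (map (\<lambda>v. of_bool (v \<in> H s)) vs) = length s"
      using that len by (simp add: S_set_def)
    fix l assume "l < length (map (\<lambda>v. of_bool (v \<in> H s)) vs :: int list)"
    then have l: "l < length vs" by simp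
    have "s ! l \<in> set s" using l ls by simp
    then have "s ! l \<in> {0, 1}" using that by (auto simp: S_set_def)
    moreover have "vs ! l \<in> H s \<longleftrightarrow> s ! l = 1"
      using l d by (auto simp: H_def nth_eq_iff_index_eq)
    ultimately show "map (\<lambda>v. of_bool (v \<in> H s)) vs ! l = s ! l" using l by auto
  qed
  have HV: "H s \<subseteq> V" for s using V by (auto simp: H_def)
  have right: "H (map (\<lambda>v. of_bool (v \<in> S)) vs) = S" if "S \<subseteq> V" for S
  proof -
    have "H (map (\<lambda>v. of_bool (v \<in> S)) vs) = {vs ! l |l. l < length vs \<and> vs ! l \<in> S}"
      by (simp add: H_def cong: conj_cong)
    also have "\<dots> = S" using that unfolding V[symmetric] set_conv_nth by blast
    finally show ?thesis .
  qed
  show ?thesis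
  proof (rule sum.reindex_bij_witness[of _ "\<lambda>S. map (\<lambda>v. of_bool (v \<in> S)) vs" H])
    fix s assume s: "s \<in> S_set (card V) i"
    show "H s \<in> {S. S \<subseteq> V \<and> card S = i}"
      using sum[OF HV, of s] left[OF s] HV[of s] s by (simp add: S_set_def)
  qed (use left right sum len in \<open>auto simp: S_set_def\<close>)
qed

text \<open>A product of two 0-1 values is 1 iff both variables lie in \<open>S\<close>. An
  \<open>Xvar\<close> never equals a \<open>Yvar\<close>, so \<open>poly_at_var_mult\<close>
  applies; by \<open>xy\<close> every variable that occurs is in the ordering, so
  \<open>map_of\<close> always finds a value.\<close>

lemma subst_mat_eq_label_mat:
  assumes vs: "is_ordering_of vs V"
    and A: "A = mat n n (\<lambda>(i, j). var_poly (Xvar (x i j)) * var_poly (Yvar (y i j)))"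
    and xy: "\<And>i j. i < n \<Longrightarrow> j < n \<Longrightarrow> {Xvar (x i j), Yvar (y i j)} \<subseteq> V"
  shows "subst_mat vs A (map (\<lambda>v. of_bool (v \<in> S)) vs) =
    label_mat n (\<lambda>i j. {Xvar (x i j), Yvar (y i j)}) S"
proof -
  have "set vs = V" using vs by (simp add: is_ordering_of_def)
  then have "map_of (zip vs (map (\<lambda>v. of_bool (v \<in> S)) vs)) v = Some (of_bool (v \<in> S) :: int)"
    if "v \<in> V" for v using that by (simp add: map_of_zip_map)
  then show ?thesis
    using xy by (intro eq_matI) (auto simp: subst_mat_def label_mat_def A poly_at_var_mult)
qed

section \<open>The sieve for two families of diagonals and for one\<close>

lemma card_bipartite_labels:
  fixes f g :: "nat \<Rightarrow> nat"
  shows "card (\<Union>i\<in>{0..<n}. {Xvar (f i), Yvar (g i)}) = card (f ` {0..<n}) + card (g ` {0..<n})"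
proof -
  have "(\<Union>i\<in>{0..<n}. {Xvar (f i), Yvar (g i)}) = Xvar ` f ` {0..<n} \<union> Yvar ` g ` {0..<n}"
    by auto
  moreover have "card (Xvar ` f ` {0..<n} \<union> Yvar ` g ` {0..<n}) =
      card (Xvar ` f ` {0..<n}) + card (Yvar ` g ` {0..<n})"
    by (rule card_Un_disjoint) auto
  ultimately show ?thesis by (simp add: card_image inj_on_def)
qed

text \<open>The sieve with \<open>k = 2 * n\<close>, its sum grouped by the size \<open>i\<close> of
  \<open>S\<close>. Each family contributes at most \<open>n\<close> labels, so the total is
  \<open>2 * n\<close> iff both maps are injective.\<close>

lemma card_permutes_two_labels:
  assumes n: "n \<ge> 1" and vs: "is_ordering_of vs V" and m: "card V = m" "2 * n \<le> m"
    and A: "A = mat n n (\<lambda>(i, j). var_poly (Xvar (x i j)) * var_poly (Yvar (y i j)))"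
    and xy: "\<And>i j. i < n \<Longrightarrow> j < n \<Longrightarrow> {Xvar (x i j), Yvar (y i j)} \<subseteq> V"
  shows "int (card {p. p permutes {0..<n} \<and>
      inj_on (\<lambda>i. x i (p i)) {0..<n} \<and> inj_on (\<lambda>i. y i (p i)) {0..<n}}) =
    (\<Sum>i=1..2*n. (-1) ^ i * int ((m - i) choose (2*n - i)) *
      (\<Sum>s\<in>S_set m i. permanent (subst_mat vs A s)))"
proof -
  let ?lab = "\<lambda>i j. {Xvar (x i j), Yvar (y i j)}"
  let ?F = "\<lambda>S. (-1) ^ (card S + 2*n) * permanent (label_mat n ?lab S) *
      int (binom (card V - card S) (int (2*n) - int (card S)))"
  have fV: "finite V" using vs by (auto simp: is_ordering_of_def)
  have le: "card (f ` {0..<n}) \<le> n" for f :: "nat \<Rightarrow> nat"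
    using card_image_le[of "{0..<n}" f] by simp
  have inj: "inj_on f {0..<n} \<longleftrightarrow> card (f ` {0..<n}) = n" for f :: "nat \<Rightarrow> nat"
    using inj_on_iff_eq_card[of "{0..<n}" f] by simp
  have "int (card {p. p permutes {0..<n} \<and>
      inj_on (\<lambda>i. x i (p i)) {0..<n} \<and> inj_on (\<lambda>i. y i (p i)) {0..<n}}) =
    int (card {p. p permutes {0..<n} \<and> card (\<Union>i\<in>{0..<n}. ?lab i (p i)) = 2 * n})"
  proof -
    have "inj_on f {0..<n} \<and> inj_on g {0..<n} \<longleftrightarrow> card (f ` {0..<n}) + card (g ` {0..<n}) = 2 * n"
      for f g :: "nat \<Rightarrow> nat"
      unfolding inj using le[of f] le[of g] by linarith
    then show ?thesis unfolding card_bipartite_labels by simp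
  qed
  also have "\<dots> = (\<Sum>S\<in>Pow V. ?F S)"
  proof (rule card_permutes_sieve[OF fV])
    show "card (\<Union>i\<in>{0..<n}. ?lab i (p i)) \<le> 2 * n" for p
      unfolding card_bipartite_labels
      using le[of "\<lambda>i. x i (p i)"] le[of "\<lambda>i. y i (p i)"] by linarith
  qed (use m xy in auto)
  also have "\<dots> = (\<Sum>i\<le>m. \<Sum>S | S \<in> Pow V \<and> card S = i. ?F S)"
    using fV m by (intro sum.group[symmetric]) (auto intro: card_mono)
  \<comment> \<open>Sizes above \<open>2 * n\<close> drop out through \<open>binom\<close>. Size 0
    gives the zero matrix, whose permanent is 0 because \<open>n \<ge> 1\<close> provides a
    row.\<close>
  also have "\<dots> = (\<Sum>i=1..2*n. \<Sum>S | S \<in> Pow V \<and> card S = i. ?F S)"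
  proof (intro sum.mono_neutral_right ballI)
    fix i assume i: "i \<in> {..m} - {1..2*n}"
    have "?F S = 0" if "S \<in> Pow V" "card S = i" for S
    proof (cases "i = 0")
      case True
      then have "S = {}" using that finite_subset[OF _ fV, of S] by auto
      then have "permanent (label_mat n ?lab S) = 0"
        unfolding permanent_label_mat using n True \<open>S = {}\<close>
          by (intro sum.neutral) (auto intro: exI[of _ 0])
      then show ?thesis by simp
    qed (use i that in \<open>auto simp: binom_def\<close>)
    then show "(\<Sum>S | S \<in> Pow V \<and> card S = i. ?F S) = 0" by (intro sum.neutral) auto
  qed (use m in auto)
  also have "\<dots> = (\<Sum>i=1..2*n. (-1) ^ i * int ((m - i) choose (2*n - i)) *
      (\<Sum>s\<in>S_set m i. permanent (subst_mat vs A s)))"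
  proof (rule sum.cong[OF refl])
    fix i assume i: "i \<in> {1..2*n}"
    have *: "nat (2 * int n - int i) = 2 * n - i" by linarith
    have "(\<Sum>S | S \<in> Pow V \<and> card S = i. ?F S) = (\<Sum>S | S \<subseteq> V \<and> card S = i.
        (-1) ^ i * int ((m - i) choose (2*n - i)) * permanent (label_mat n ?lab S))"
      \<comment> \<open>The even part \<open>2*n\<close> of the exponent does not affect the
        sign.\<close>
      using i m by (intro sum.cong) (auto simp: binom_def power_add *)
    moreover have "(\<Sum>s\<in>S_set m i. permanent (subst_mat vs A s)) =
        (\<Sum>S | S \<subseteq> V \<and> card S = i. permanent (label_mat n ?lab S))"
      unfolding m(1)[symmetric] sum_S_set[OF vs] by (simp add: subst_mat_eq_label_mat[OF vs A xy])
    ultimately show "(\<Sum>S | S \<in> Pow V \<and> card S = i. ?F S) =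
        (-1) ^ i * int ((m - i) choose (2*n - i)) * (\<Sum>s\<in>S_set m i. permanent (subst_mat vs A s))"
      by (simp add: sum_distrib_left)
  qed
  finally show ?thesis .
qed

text \<open>With singleton labels the labels met form the image of \<open>{0..<n}\<close>: at most
  \<open>n\<close> elements, and exactly \<open>n\<close> iff the map is injective.\<close>

lemma card_permutes_one_label:
  assumes V: "finite V" "n \<le> card V" and d: "\<And>i j. i < n \<Longrightarrow> j < n \<Longrightarrow> d i j \<in> V"
  shows "int (card {p. p permutes {0..<n} \<and> inj_on (\<lambda>i. d i (p i)) {0..<n}}) =
    (\<Sum>D\<in>Pow V. (-1) ^ (card D + n) * permanent (label_mat n (\<lambda>i j. {d i j}) D) *
      int (binom (card V - card D) (int n - int (card D))))"
proof -
  have U: "(\<Union>i\<in>{0..<n}. {d i (p i)}) = (\<lambda>i. d i (p i)) ` {0..<n}" for p by auto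
  have "inj_on (\<lambda>i. d i (p i)) {0..<n} \<longleftrightarrow> card (\<Union>i\<in>{0..<n}. {d i (p i)}) = n" for p
    unfolding U using inj_on_iff_eq_card[of "{0..<n}"] by auto
  moreover have "card (\<Union>i\<in>{0..<n}. {d i (p i)}) \<le> n" for p
    unfolding U using card_image_le[of "{0..<n}" "\<lambda>i. d i (p i)"] by simp
  ultimately show ?thesis
    using card_permutes_sieve[OF V, of n "\<lambda>i j. {d i j}"] d by simp
qed

section \<open>The four counting formulas\<close>

text \<open>The subscripts of the x and y variables at a square are \<open>j - i\<close> and
  \<open>- (i + j)\<close> up to constants, so distinct variables mean distinct diagonals. There are
  \<open>4*n - 2\<close> variables, at least \<open>2*n\<close> since
  \<open>n \<ge> 1\<close>.\<close>

lemma queens_formula: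
  assumes n: "n \<ge> 1" and qs: "is_ordering_of qs (Q_vars n)"
  shows "int (queens n) =
      (\<Sum>i=1..2*n. (-1) ^ i * int ((4*n - i - 2) choose (2*n - i)) *
        (\<Sum>s\<in>S_set (4*n - 2) i. permanent (subst_mat qs (Q_mat n) s)))"
proof -
  let ?x = "\<lambda>i j. n - (i + 1) + (j + 1)" and ?y = "\<lambda>i j. 2*n - (i + 1) - (j + 1) + 1"
  have "card (Q_vars n) = card (Xvar ` {1..2*n-1}) + card (Yvar ` {1..2*n-1})"
    unfolding Q_vars_def by (rule card_Un_disjoint) auto
  then have c: "card (Q_vars n) = 4 * n - 2" by (simp add: card_image inj_on_def)
  have "inj_on (\<lambda>i. int (p i + 1) - int (i + 1)) {0..<n} \<longleftrightarrow> inj_on (\<lambda>i. ?x i (p i)) {0..<n}"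
    for p
    unfolding inj_on_def by (intro ball_cong refl) auto
  moreover have "inj_on (\<lambda>i. i + 1 + (p i + 1)) {0..<n} \<longleftrightarrow> inj_on (\<lambda>i. ?y i (p i)) {0..<n}"
    if "p permutes {0..<n}" for p
  proof -
    \<comment> \<open>The y subscript subtracts the column, so this bound is needed to avoid
      truncation.\<close>
    have p: "p i < n" if "i < n" for i using permutes_in_image[OF \<open>p permutes _\<close>] that by simp
    have "i + 1 + (p i + 1) = j + 1 + (p j + 1) \<longleftrightarrow> ?y i (p i) = ?y j (p j)"
      if "i < n" "j < n" for i j using that p[of i] p[of j] by linarith
    then show ?thesis by (simp add: inj_on_def)
  qed
  ultimately have "queens n = card {p. p permutes {0..<n} \<and>
      inj_on (\<lambda>i. ?x i (p i)) {0..<n} \<and> inj_on (\<lambda>i. ?y i (p i)) {0..<n}}"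
    unfolding queens_def card_placements_permutes inj_on_placement prod.case
    by (metis (no_types, lifting))
  moreover have "Q_mat n = mat n n (\<lambda>(i, j). var_poly (Xvar (?x i j)) * var_poly (Yvar (?y i j)))"
    by (simp add: Q_mat_def square_mat_from_1_def)
  moreover have "{Xvar (?x i j), Yvar (?y i j)} \<subseteq> Q_vars n" if "i < n" "j < n" for i j
    using that by (auto simp: Q_vars_def)
  moreover have "4*n - i - 2 = (4*n - 2) - i" for i by simp
  ultimately show ?thesis
    using card_permutes_two_labels[OF n qs c, of "Q_mat n" ?x ?y] n by simp
qed

text \<open>Here the number of variables equals \<open>k = 2*n\<close>, so the binomial weight is 1.
  It remains to match the subscripts mod \<open>n\<close> with the toroidal diagonals.\<close>

lemma toroidal_queens_formula:
  assumes n: "n \<ge> 1" and ts: "is_ordering_of ts (T_vars n)"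
  shows "int (toroidal_queens n) =
      (\<Sum>i=1..2*n. (-1) ^ i * (\<Sum>s\<in>S_set (2*n) i. permanent (subst_mat ts (T_mat n) s)))"
proof -
  let ?x = "\<lambda>i j. (n - (i + 1) + (j + 1)) mod n"
    and ?y = "\<lambda>i j. (2*n - (i + 1) - (j + 1) + 1) mod n"
  have "card (T_vars n) = card (Xvar ` {0..<n}) + card (Yvar ` {0..<n})"
    unfolding T_vars_def by (rule card_Un_disjoint) auto
  then have c: "card (T_vars n) = 2 * n" by (simp add: card_image inj_on_def)
  have x: "(int (j + 1) - int (i + 1)) mod int n = (int (j' + 1) - int (i' + 1)) mod int n \<longleftrightarrow>
      ?x i j = ?x i' j'" if "i < n" "i' < n" for i i' j j'
  proof -
    have e: "int (?x i j) = (int (j + 1) - int (i + 1)) mod int n" if "i < n" for i j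
    proof -
      have "int (n - (i + 1) + (j + 1)) = (int (j + 1) - int (i + 1)) + int n"
        using that by simp
      then show ?thesis by (simp only: zmod_int mod_add_self2)
    qed
    show ?thesis unfolding e[OF that(1), symmetric] e[OF that(2), symmetric] of_nat_eq_iff ..
  qed
  have y: "(i + 1 + (j + 1)) mod n = (i' + 1 + (j' + 1)) mod n \<longleftrightarrow> ?y i j = ?y i' j'"
    if "i < n" "i' < n" "j < n" "j' < n" for i i' j j'
  proof -
    \<comment> \<open>Modulo \<open>n\<close> the subscript is 1 minus the antidiagonal number.
      Reflection and translation preserve congruence, but the reflection swaps the two sides, which
      is undone at the end.\<close>
    have e: "int (?y i j) = (1 - int (i + 1 + (j + 1))) mod int n" if "i < n" "j < n" for i j
    proof -
      have "int (2*n - (i + 1) - (j + 1) + 1) = (1 - int (i + 1 + (j + 1))) + 2 * int n"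
        using that by simp
      then show ?thesis by (simp only: zmod_int mod_mult_self1)
    qed
    have "?y i j = ?y i' j' \<longleftrightarrow>
        (1 - int (i + 1 + (j + 1))) mod int n = (1 - int (i' + 1 + (j' + 1))) mod int n"
      unfolding e[OF that(1,3), symmetric] e[OF that(2,4), symmetric] of_nat_eq_iff ..
    also have "\<dots> \<longleftrightarrow> int (i' + 1 + (j' + 1)) mod int n = int (i + 1 + (j + 1)) mod int n"
      unfolding mod_eq_dvd_iff by (simp add: algebra_simps)
    also have "\<dots> \<longleftrightarrow> (i + 1 + (j + 1)) mod n = (i' + 1 + (j' + 1)) mod n"
      unfolding zmod_int[symmetric] of_nat_eq_iff by (rule eq_commute)
    finally show ?thesis by (rule sym)
  qed
  have "inj_on (\<lambda>i. (int (p i + 1) - int (i + 1)) mod int n) {0..<n} \<longleftrightarrow>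
      inj_on (\<lambda>i. ?x i (p i)) {0..<n}" for p
    unfolding inj_on_def using x by (intro ball_cong refl) auto
  moreover have "inj_on (\<lambda>i. (i + 1 + (p i + 1)) mod n) {0..<n} \<longleftrightarrow>
      inj_on (\<lambda>i. ?y i (p i)) {0..<n}"
    if "p permutes {0..<n}" for p
    unfolding inj_on_def using y permutes_in_image[OF that] by (intro ball_cong refl) auto
  ultimately have "toroidal_queens n = card {p. p permutes {0..<n} \<and>
      inj_on (\<lambda>i. ?x i (p i)) {0..<n} \<and> inj_on (\<lambda>i. ?y i (p i)) {0..<n}}"
    unfolding toroidal_queens_def card_placements_permutes inj_on_placement prod.case
    by (metis (no_types, lifting))
  moreover have "T_mat n = mat n n (\<lambda>(i, j). var_poly (Xvar (?x i j)) * var_poly (Yvar (?y i j)))"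
    by (simp add: T_mat_def square_mat_from_1_def)
  moreover have "{Xvar (?x i j), Yvar (?y i j)} \<subseteq> T_vars n" if "i < n" "j < n" for i j
    using that by (auto simp: T_vars_def)
  ultimately show ?thesis
    using card_permutes_two_labels[OF n ts c, of "T_mat n" ?x ?y] n by simp
qed

text \<open>\<open>D\<close> and \<open>?M\<close> are inverse bijections between
  \<open>U_set n\<close> and the sets of the \<open>2*n - 1\<close> diagonals, taking
  \<open>\<gamma>\<close> to cardinality; the sieve with \<open>k = n\<close> is transported along
  them.\<close>

lemma semi_queens_formula:
  assumes n: "n \<ge> 1"
  shows "int (semi_queens n) =
      (\<Sum>M\<in>U_set n. (-1) ^ (\<gamma> M + n) * permanent M *
        int (binom (2*n - \<gamma> M - 1) (int n - int (\<gamma> M))))"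
proof -
  let ?d = "\<lambda>i j. int j - int i"
  define V where "V = {- (int n - 1)..int n - 1}"
  define D where "D M = {d \<in> V. \<forall>i<n. \<forall>j<n. int j - int i = d \<longrightarrow> M $$ (i, j) = 1}" for M :: "int mat"
  let ?M = "label_mat n (\<lambda>i j. {?d i j})"
  have fV: "finite V" and cV: "card V = 2 * n - 1" unfolding V_def by auto
  have dV: "?d i j \<in> V" if "i < n" "j < n" for i j using that by (auto simp: V_def)
  have gD: "\<gamma> M = card (D M)" if "M \<in> carrier_mat n n" for M
    using that by (simp add: \<gamma>_def D_def V_def Let_def)
  have exd: "\<exists>i j. i < n \<and> j < n \<and> ?d i j = d" if "d \<in> V" for d
  proof -
    \<comment> \<open>The first square of the diagonal: since \<open>nat\<close> sends negatives to
      0, it lies in the top row or the left column. So no diagonal is empty and membership in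
      \<open>D\<close> is never vacuous.\<close>
    have "nat (- d) < n \<and> nat d < n \<and> ?d (nat (- d)) (nat d) = d"
      using that n by (auto simp: V_def)
    then show ?thesis by blast
  qed
  have left: "D (?M S) = S" if S: "S \<subseteq> V" for S
  proof -
    have "d \<in> S" if "d \<in> D (?M S)" for d
    proof -
      have "d \<in> V" using that by (simp add: D_def)
      then obtain i j where "i < n" "j < n" "?d i j = d" using exd by blast
      then show ?thesis using that by (auto simp: D_def label_mat_def split: if_splits)
    qed
    moreover have "d \<in> D (?M S)" if "d \<in> S" for d
      using that S by (auto simp: D_def label_mat_def)
    ultimately show ?thesis by blast
  qed
  have DV: "D M \<subseteq> V" for M by (auto simp: D_def)
  have MU: "?M S \<in> U_set n" for S
    by (auto simp: U_set_def label_mat_def elements_mat_def)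
  have shift: "M $$ (i + k, j + k) = M $$ (i, j)"
    if "M \<in> U_set n" "i + k < n" "j + k < n" for M i j k
    using that(2,3)
  proof (induction k)
    case (Suc k)
    then have "M $$ (i + k, j + k) = M $$ (i + k + 1, j + k + 1)"
      using that(1) by (simp add: U_set_def)
    then show ?case using Suc by simp
  qed simp
  have same: "M $$ (i, j) = M $$ (i', j')"
    if "M \<in> U_set n" "i < n" "j < n" "i' < n" "j' < n" "?d i j = ?d i' j'" for M i j i' j'
  proof (cases "i \<le> i'")
    case True
    then have "i' = i + (i' - i)" "j' = j + (i' - i)" using that by auto
    then show ?thesis using shift[OF that(1), of i "i' - i" j] that by metis
  next
    case False
    then have "i = i' + (i - i')" "j = j' + (i - i')" using that by auto
    then show ?thesis using shift[OF that(1), of i' "i - i'" j'] that by metis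
  qed
  have right: "?M (D M) = M" if M: "M \<in> U_set n" for M
  proof (rule eq_matI)
    have cM: "M \<in> carrier_mat n n" using M unfolding U_set_def by blast
    then show "dim_row (?M (D M)) = dim_row M" "dim_col (?M (D M)) = dim_col M"
      by (auto simp: label_mat_def)
    fix i j assume "i < dim_row M" "j < dim_col M"
    then have ij: "i < n" "j < n" using cM by auto
    have "M $$ (i, j) \<in> {0, 1}" using M elements_matI[OF cM ij refl] unfolding U_set_def by blast
    moreover have "?d i j \<in> D M \<longleftrightarrow> M $$ (i, j) = 1"
    proof
      show "M $$ (i, j) = 1" if "?d i j \<in> D M" using that ij by (simp add: D_def)
      assume 1: "M $$ (i, j) = 1"
      \<comment> \<open>A single 1 forces ones on its whole diagonal, since \<open>M\<close> is
        constant there.\<close>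
      have "M $$ (i', j') = 1" if "i' < n" "j' < n" "?d i' j' = ?d i j" for i' j'
        using same[OF M that(1,2) ij that(3)] 1 by (rule trans)
      then show "?d i j \<in> D M" using dV[OF ij] unfolding D_def by blast
    qed
    ultimately show "?M (D M) $$ (i, j) = M $$ (i, j)" using ij by (auto simp: label_mat_def)
  qed
  have "semi_queens n = card {p. p permutes {0..<n} \<and> inj_on (\<lambda>i. ?d i (p i)) {0..<n}}"
    unfolding semi_queens_def card_placements_permutes inj_on_placement by simp
  also have "int \<dots> = (\<Sum>S\<in>Pow V. (-1) ^ (card S + n) * permanent (?M S) *
      int (binom (card V - card S) (int n - int (card S))))"
    using n cV dV by (intro card_permutes_one_label fV) auto
  also have "\<dots> = (\<Sum>M\<in>U_set n. (-1) ^ (\<gamma> M + n) * permanent M *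
        int (binom (2*n - \<gamma> M - 1) (int n - int (\<gamma> M))))"
  proof (rule sum.reindex_bij_witness[of _ D ?M])
    fix S assume S: "S \<in> Pow V"
    then have "\<gamma> (?M S) = card S" using left gD by (simp add: label_mat_def)
    then show "(-1) ^ (\<gamma> (?M S) + n) * permanent (?M S) *
        int (binom (2*n - \<gamma> (?M S) - 1) (int n - int (\<gamma> (?M S)))) =
      (-1) ^ (card S + n) * permanent (?M S) * int (binom (card V - card S) (int n - int (card S)))"
      by (simp add: cV)
  qed (use left right MU DV in auto)
  finally show ?thesis .
qed

text \<open>A circulant matrix is determined by its first row, where column \<open>j\<close> lies on
  the toroidal diagonal \<open>j\<close>; so \<open>D\<close> reads off the set of diagonals of
  ones. There are \<open>n\<close> diagonals and \<open>k = n\<close>, so the binomial weight is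
  1.\<close>

lemma toroidal_semi_queens_formula:
  assumes n: "n \<ge> 1"
  shows "int (toroidal_semi_queens n) = (\<Sum>M\<in>V_set n. (-1) ^ (\<sigma> M + n) * permanent M)"
proof -
  let ?d = "\<lambda>i j. (int j - int i) mod int n"
  define V where "V = {0..<int n}"
  define D where "D M = int ` {j. j < n \<and> M $$ (0, j) = 1}" for M :: "int mat"
  let ?M = "label_mat n (\<lambda>i j. {?d i j})"
  have fV: "finite V" and cV: "card V = n" unfolding V_def by auto
  have dV: "?d i j \<in> V" for i j using n by (simp add: V_def)
  have sD: "\<sigma> M = card (D M)" if "M \<in> carrier_mat n n" for M
    using that by (simp add: \<sigma>_def D_def card_image)
  have left: "D (?M S) = S" if S: "S \<subseteq> V" for S
  proof -
    have "D (?M S) = int ` {j. j < n \<and> int j \<in> S}"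
      using n unfolding D_def label_mat_def
      by (intro arg_cong[where f = "(`) int"] Collect_cong) auto
    also have "\<dots> = S"
      using S by (force simp: V_def image_iff intro: exI[of _ "nat _"])
    finally show ?thesis .
  qed
  have DV: "D M \<subseteq> V" for M by (auto simp: D_def V_def)
  have MV: "?M S \<in> V_set n" for S
  proof -
    have "?d i j = ?d ((i + 1) mod n) ((j + 1) mod n)" for i j
      by (simp add: zmod_int mod_diff_eq)
    then show ?thesis
      using n by (auto simp: V_set_def label_mat_def elements_mat_def)
  qed
  have shift: "M $$ (i, j) = M $$ (0, nat (?d i j))" if "M \<in> V_set n" "i < n" "j < n" for M i j
    using that(2,3)
  proof (induction i arbitrary: j)
    case 0
    then show ?case by simp
  next
    case (Suc i)
    \<comment> \<open>The cyclic predecessor of \<open>j\<close>; adding \<open>n\<close> first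
      avoids truncation at \<open>j = 0\<close>. Moving one row up and one column left keeps the
      toroidal diagonal, and induction reaches row 0.\<close>
    define j' where "j' = (j + n - 1) mod n"
    have "(j' + 1) mod n = (j + n - 1 + 1) mod n"
      unfolding j'_def by (rule mod_add_left_eq)
    then have j': "j' < n" "(j' + 1) mod n = j"
      using Suc.prems by (simp_all add: j'_def)
    have "M $$ (i, j') = M $$ (Suc i, j)"
    proof -
      have "\<forall>i<n. \<forall>j<n. M $$ (i, j) = M $$ ((i + 1) mod n, (j + 1) mod n)"
        using that(1) unfolding V_set_def by blast
      from this[rule_format, of i j'] show ?thesis using Suc.prems j' by simp
    qed
    moreover have "?d i j' = ?d (Suc i) j"
    proof -
      have "int j' = (int j - 1 + int n) mod int n"
        using Suc.prems by (simp add: j'_def zmod_int of_nat_diff algebra_simps)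
      then have "int j' = (int j - 1) mod int n" by simp
      then show ?thesis by (simp add: mod_diff_left_eq algebra_simps)
    qed
    ultimately show ?case using Suc.IH[of j'] Suc.prems j' by simp
  qed
  have right: "?M (D M) = M" if M: "M \<in> V_set n" for M
  proof (rule eq_matI)
    have cM: "M \<in> carrier_mat n n" using M unfolding V_set_def by blast
    then show "dim_row (?M (D M)) = dim_row M" "dim_col (?M (D M)) = dim_col M"
      by (auto simp: label_mat_def)
    fix i j assume "i < dim_row M" "j < dim_col M"
    then have ij: "i < n" "j < n" using cM by auto
    have "M $$ (i, j) \<in> {0, 1}" using M elements_matI[OF cM ij refl] unfolding V_set_def by blast
    moreover have "?d i j \<in> D M \<longleftrightarrow> M $$ (i, j) = 1"
    proof -
      obtain k where k: "?d i j = int k" "k < n"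
        using dV[of j i] by (metis V_def atLeastLessThan_iff nonneg_int_cases of_nat_less_iff)
      then have "?d i j \<in> D M \<longleftrightarrow> M $$ (0, nat (?d i j)) = 1"
        by (auto simp: D_def)
      then show ?thesis using shift[OF M ij] by simp
    qed
    ultimately show "?M (D M) $$ (i, j) = M $$ (i, j)" using ij by (auto simp: label_mat_def)
  qed
  have "toroidal_semi_queens n = card {p. p permutes {0..<n} \<and> inj_on (\<lambda>i. ?d i (p i)) {0..<n}}"
    unfolding toroidal_semi_queens_def card_placements_permutes inj_on_placement by simp
  also have "int \<dots> = (\<Sum>S\<in>Pow V. (-1) ^ (card S + n) * permanent (?M S) *
      int (binom (card V - card S) (int n - int (card S))))"
    using cV dV by (intro card_permutes_one_label fV) auto
  also have "\<dots> = (\<Sum>M\<in>V_set n. (-1) ^ (\<sigma> M + n) * permanent M)"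
  proof (rule sum.reindex_bij_witness[of _ D ?M])
    fix S assume S: "S \<in> Pow V"
    then have "\<sigma> (?M S) = card S" using left sD by (simp add: label_mat_def)
    moreover have "card S \<le> n" using S card_mono[OF fV] cV by auto
    ultimately show "(-1) ^ (\<sigma> (?M S) + n) * permanent (?M S) =
      (-1) ^ (card S + n) * permanent (?M S) * int (binom (card V - card S) (int n - int (card S)))"
      by (simp add: cV binom_def nat_diff_distrib)
  qed (use left right MV DV in auto)
  finally show ?thesis .
qed

theorem theorem3p6:
  fixes n :: nat and qs ts :: "matvar list"
  assumes "n \<ge> 1"
    and "is_ordering_of qs (Q_vars n)"
    and "is_ordering_of ts (T_vars n)"
  shows "(int (queens n) =
      (\<Sum>i=1..2*n. (-1) ^ i * int ((4*n - i - 2) choose (2*n - i)) *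
        (\<Sum>s\<in>S_set (4*n - 2) i. permanent (subst_mat qs (Q_mat n) s)))) \<and>
    (int (toroidal_queens n) =
      (\<Sum>i=1..2*n. (-1) ^ i * (\<Sum>s\<in>S_set (2*n) i. permanent (subst_mat ts (T_mat n) s)))) \<and>
    (int (semi_queens n) =
      (\<Sum>M\<in>U_set n. (-1) ^ (\<gamma> M + n) * permanent M *
        int (binom (2*n - \<gamma> M - 1) (int n - int (\<gamma> M))))) \<and>
    (int (toroidal_semi_queens n) =
      (\<Sum>M\<in>V_set n. (-1) ^ (\<sigma> M + n) * permanent M))"
  using assms queens_formula toroidal_queens_formula semi_queens_formula
    toroidal_semi_queens_formula by blast

end
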